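(* Let $(X,\operatorname{dist})$ be a compact metric space with infinitely many points and let $f\colon X\to X$ be a separating homeomorphism. Then there are positively asymptotic points, that is, there are $x,y\in X$ with $x\neq y$ such that $\operatorname{dist}(f^n(x),f^n(y))\to 0$ as $n\to+\infty$.
   Context: The orbit of $x\in X$ under a homeomorphism $f\colon X\to X$ is $O(x)=\{f^n(x):n\in\mathbb Z\}$. A homeomorphism $f$ of a compact metric space $(X,\operatorname{dist})$ is separating if there is $\eta>0$ such that whenever $x,y\in X$ and $y\notin O(x)$, one has $\operatorname{dist}(f^n(x),f^n(y))>\eta$ for some $n\in\mathbb Z$. *)

theory Defs
  imports "HOL-Analysis.Analysis"
begin

text \<open>
  A compact metric space is a compact set \<open>X\<close> in a type of class \<open>metric_space\<close>, with the
  induced metric. A self-map of \<open>X\<close> is a total function whose values outside \<open>X\<close> are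
  irrelevant.
\<close>

definition self_homeomorphism :: "'a::topological_space set \<Rightarrow> ('a \<Rightarrow> 'a) \<Rightarrow> bool" where
  "self_homeomorphism X f \<longleftrightarrow> (\<exists>g. homeomorphism X X f g)"

text \<open>The inverse is taken relative to \<open>X\<close>, since \<open>f\<close> need not be injective on the whole type.\<close>

definition int_iterate :: "'a set \<Rightarrow> ('a \<Rightarrow> 'a) \<Rightarrow> int \<Rightarrow> 'a \<Rightarrow> 'a" where
  "int_iterate X f n =
     (if 0 \<le> n then f ^^ nat n else inv_into X f ^^ nat (- n))"

definition orbit_on :: "'a set \<Rightarrow> ('a \<Rightarrow> 'a) \<Rightarrow> 'a \<Rightarrow> 'a set" where
  "orbit_on X f x = range (\<lambda>n::int. int_iterate X f n x)"

definition separating_homeomorphism :: "'a::metric_space set \<Rightarrow> ('a \<Rightarrow> 'a) \<Rightarrow> bool" where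
  "separating_homeomorphism X f \<longleftrightarrow>
     self_homeomorphism X f \<and>
     (\<exists>\<eta>>0. \<forall>x\<in>X. \<forall>y\<in>X. y \<notin> orbit_on X f x \<longrightarrow>
        (\<exists>n::int. dist (int_iterate X f n x) (int_iterate X f n y) > \<eta>))"

end

theory Submission
  imports Defs
begin

text \<open>
  Iterating \<open>f\<close> and its inverse gives an action of the integers on \<open>X\<close>, and the argument is
  carried out for such actions. For expansive actions on infinite spaces the existence of asymptotic
  pairs is classical; the obstacle is that separation says nothing about two points of one orbit,
  which might stay close forever. Three
  observations remove it.

  First (\<open>nonperiodic_orbit_discrete\<close>): a single nonperiodic orbit is uniformly discrete for the
  metric \<open>sup\<^sub>n dist (T n x) (T n y)\<close>. By separation, every uniform limit of points of the
  orbit lies in the orbit again, so the orbit is complete for this metric. It is also countable and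
  homogeneous, and a complete homogeneous countable space is discrete by Baire's argument.

  Second (\<open>infinite_minimal_asymptotic\<close>): on an infinite minimal set the constant of discreteness
  of one orbit serves for all orbits, because the points that stay close to a fixed iterate of
  themselves form a closed invariant set. Hence the action is expansive there. If there were no
  asymptotic pair, it would be positively expansive, and then closeness would propagate into the
  whole past, which fails for two nearby points of one orbit.

  Third (\<open>asymptotic_at_entrance\<close>): if points of \<open>X\<close> accumulate at a periodic point
  \<open>p\<close> but their pasts leave a neighbourhood of the orbit of \<open>p\<close>, the last times at which they
  enter the neighbourhood have a limit that stays near this orbit in the future and is not on it at
  the matching phase. Orbits near a periodic orbit forever coincide with it by separation, so this
  limit is asymptotic to a periodic point.

  The theorem follows. If there is a nonperiodic point, take a minimal set in its omega-limit set: it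
  is either infinite, or a periodic orbit at which the given orbit accumulates. If all points are
  periodic, an accumulation point of the infinite set \<open>X\<close> is a periodic point at which other
  periodic orbits accumulate. The third observation applies in the last two cases.
\<close>

section \<open>Integer actions on compact metric spaces\<close>

locale compact_int_action =
  fixes X :: "'a::metric_space set" and T :: "int \<Rightarrow> 'a \<Rightarrow> 'a"
  assumes compact_space: "compact X"
    and act_zero: "x \<in> X \<Longrightarrow> T 0 x = x"
    and act_add: "x \<in> X \<Longrightarrow> T (m + n) x = T m (T n x)"
    and act_in: "x \<in> X \<Longrightarrow> T n x \<in> X"
    and act_cont: "continuous_on X (T n)"
begin

definition orb :: "'a \<Rightarrow> 'a set" where
  "orb x = range (\<lambda>n. T n x)"

definition periodic :: "'a \<Rightarrow> bool" where
  "periodic x \<longleftrightarrow> (\<exists>k>0. T k x = x)"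

definition forever_close :: "real \<Rightarrow> 'a \<Rightarrow> 'a \<Rightarrow> bool" where
  "forever_close r x y \<longleftrightarrow> (\<forall>n. dist (T n x) (T n y) \<le> r)"

definition asymptotic :: "'a \<Rightarrow> 'a \<Rightarrow> bool" where
  "asymptotic x y \<longleftrightarrow> (\<lambda>n::nat. dist (T (int n) x) (T (int n) y)) \<longlonglongrightarrow> 0"

definition closed_invariant :: "'a set \<Rightarrow> bool" where
  "closed_invariant S \<longleftrightarrow> closed S \<and> S \<subseteq> X \<and> (\<forall>x\<in>S. \<forall>n. T n x \<in> S)"

definition minimal :: "'a set \<Rightarrow> bool" where
  "minimal M \<longleftrightarrow> closed_invariant M \<and> M \<noteq> {} \<and>
     (\<forall>N. closed_invariant N \<and> N \<noteq> {} \<and> N \<subseteq> M \<longrightarrow> N = M)"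

lemma closed_space: "closed X"
  using compact_space compact_imp_closed by blast

lemma closed_invariant_space: "closed_invariant X"
  unfolding closed_invariant_def using closed_space act_in by auto

lemma closed_invariant_compact: "closed_invariant S \<Longrightarrow> compact S"
  unfolding closed_invariant_def
  using compact_Int_closed[OF compact_space, of S] by (simp add: inf.absorb2)

lemma act_inverse: "x \<in> X \<Longrightarrow> T n (T (- n) x) = x" "x \<in> X \<Longrightarrow> T (- n) (T n x) = x"
  by (simp_all flip: act_add add: act_zero)

lemma act_inj: "x \<in> X \<Longrightarrow> y \<in> X \<Longrightarrow> T n x = T n y \<Longrightarrow> x = y"
  by (metis act_inverse(2))

lemma act_tendsto:
  assumes "\<And>i. xs i \<in> X" "xs \<longlonglongrightarrow> x"
  shows "(\<lambda>i. T n (xs i)) \<longlonglongrightarrow> T n x"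
proof -
  have "x \<in> X" using closed_space assms closed_sequentially by blast
  then show ?thesis
    using assms act_cont[of n] unfolding continuous_on_sequentially by (auto simp: o_def)
qed

lemma orb_subset: "x \<in> X \<Longrightarrow> orb x \<subseteq> X"
  unfolding orb_def using act_in by auto

lemma act_in_orb: "x \<in> X \<Longrightarrow> y \<in> orb x \<Longrightarrow> T n y \<in> orb x"
  unfolding orb_def by (auto simp flip: act_add)

lemma forever_close_sym: "forever_close r x y \<Longrightarrow> forever_close r y x"
  by (simp add: forever_close_def dist_commute)

lemma forever_close_mono: "forever_close r x y \<Longrightarrow> r \<le> s \<Longrightarrow> forever_close s x y"
  unfolding forever_close_def by (meson order_trans)

lemma forever_close_act:
  assumes "x \<in> X" "y \<in> X" "forever_close r x y"
  shows "forever_close r (T k x) (T k y)"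
  using assms by (auto simp: forever_close_def simp flip: act_add)

lemma forever_close_trans:
  assumes "forever_close r x y" "forever_close s y z"
  shows "forever_close (r + s) x z"
  unfolding forever_close_def
proof
  fix n
  have "dist (T n x) (T n z) \<le> dist (T n x) (T n y) + dist (T n y) (T n z)"
    by (rule dist_triangle)
  then show "dist (T n x) (T n z) \<le> r + s"
    using assms unfolding forever_close_def by (meson add_mono order_trans)
qed

lemma dist_act_limit:
  assumes "\<And>i. xs i \<in> X" "xs \<longlonglongrightarrow> x" "\<And>i. ys i \<in> X" "ys \<longlonglongrightarrow> y"
    and "\<forall>\<^sub>F i in sequentially. dist (T n (xs i)) (T n (ys i)) \<le> r"
  shows "dist (T n x) (T n y) \<le> r"
  using tendsto_upperbound[OF tendsto_dist[OF act_tendsto act_tendsto] assms(5)] assms by simp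

lemma convergent_pair_subseq:
  fixes A :: "'b::metric_space set" and B :: "'c::metric_space set"
  assumes "compact A" "compact B" "\<And>i. xs i \<in> A" "\<And>i. ys i \<in> B"
  obtains x y s where "x \<in> A" "y \<in> B" "strict_mono (s::nat \<Rightarrow> nat)"
    "(\<lambda>i. xs (s i)) \<longlonglongrightarrow> x" "(\<lambda>i. ys (s i)) \<longlonglongrightarrow> y"
proof -
  have "seq_compact (A \<times> B)"
    using compact_Times[OF assms(1,2)] by (simp add: compact_eq_seq_compact_metric)
  then obtain l s where l: "l \<in> A \<times> B" "strict_mono (s::nat \<Rightarrow> nat)"
      "((\<lambda>i. (xs i, ys i)) \<circ> s) \<longlonglongrightarrow> l"
    using assms(3,4) by (elim seq_compactE[where f = "\<lambda>i. (xs i, ys i)"]) auto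
  show thesis
  proof (rule that)
    show "(\<lambda>i. xs (s i)) \<longlonglongrightarrow> fst l" "(\<lambda>i. ys (s i)) \<longlonglongrightarrow> snd l"
      using tendsto_fst[OF l(3)] tendsto_snd[OF l(3)] by (simp_all add: o_def)
  qed (use l in auto)
qed

lemma convergent_subseq:
  fixes A :: "'b::metric_space set"
  assumes "compact A" "\<And>i. xs i \<in> A"
  obtains x s where "x \<in> A" "strict_mono (s::nat \<Rightarrow> nat)" "(\<lambda>i. xs (s i)) \<longlonglongrightarrow> x"
proof -
  obtain x y s where "x \<in> A" "y \<in> A" "strict_mono (s::nat \<Rightarrow> nat)"
    "(\<lambda>i. xs (s i)) \<longlonglongrightarrow> x" "(\<lambda>i. xs (s i)) \<longlonglongrightarrow> y"
    by (rule convergent_pair_subseq[OF assms(1,1) assms(2,2)])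
  with that show thesis by blast
qed

lemma strict_mono_int_ge:
  assumes "strict_mono (s::nat \<Rightarrow> nat)"
  shows "\<forall>\<^sub>F i in sequentially. (n::int) \<le> int (s i)"
proof (rule eventually_sequentiallyI[of "nat n"])
  fix i assume "nat n \<le> i"
  then show "n \<le> int (s i)" using seq_suble[OF assms, of i] by linarith
qed

text \<open>
  Where the forward distances fail to tend to \<open>0\<close>, a limit of the pairs along the bad times keeps
  a positive distance, and it is close in both time directions since the bad times tend to infinity.
\<close>

lemma asymptotic_or_forever_close_pair:
  assumes S: "closed_invariant S" "x \<in> S" and R: "closed_invariant R" "y \<in> R"
    and close: "\<And>n. 0 \<le> n \<Longrightarrow> dist (T n x) (T n y) \<le> r"
    and "\<not> asymptotic x y"
  obtains u v where "u \<in> S" "v \<in> R" "u \<noteq> v" "forever_close r u v"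
proof -
  have X: "x \<in> X" "y \<in> X" using S R unfolding closed_invariant_def by auto
  obtain \<epsilon> where \<epsilon>: "\<epsilon> > 0" "\<forall>N. \<exists>n\<ge>N. dist (T (int n) x) (T (int n) y) \<ge> \<epsilon>"
    using \<open>\<not> asymptotic x y\<close> unfolding asymptotic_def LIMSEQ_iff
    by (simp only: diff_zero real_norm_def abs_of_nonneg[OF zero_le_dist] not_all not_ex not_imp not_less) blast
  then obtain a where a: "\<And>N::nat. a N \<ge> N" "\<And>N. dist (T (int (a N)) x) (T (int (a N)) y) \<ge> \<epsilon>"
    by metis
  have in_S: "T (int (a i)) x \<in> S" and in_R: "T (int (a i)) y \<in> R" for i
    using S R unfolding closed_invariant_def by auto
  obtain u v s where uv: "u \<in> S" "v \<in> R" "strict_mono (s::nat \<Rightarrow> nat)"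
    "(\<lambda>i. T (int (a (s i))) x) \<longlonglongrightarrow> u" "(\<lambda>i. T (int (a (s i))) y) \<longlonglongrightarrow> v"
    by (rule convergent_pair_subseq[OF closed_invariant_compact[OF S(1)]
          closed_invariant_compact[OF R(1)] in_S in_R])
  have "\<epsilon> \<le> dist u v"
    by (rule tendsto_lowerbound[OF tendsto_dist[OF uv(4,5)]]) (auto simp: a)
  then have "u \<noteq> v" using \<open>\<epsilon> > 0\<close> by auto
  have "forever_close r u v"
    unfolding forever_close_def
  proof
    fix n
    have "\<forall>\<^sub>F i in sequentially. - n \<le> int (s i)" by (rule strict_mono_int_ge[OF uv(3)])
    then have "\<forall>\<^sub>F i in sequentially.
        dist (T n (T (int (a (s i))) x)) (T n (T (int (a (s i))) y)) \<le> r"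
    proof eventually_elim
      case (elim i)
      then have "0 \<le> n + int (a (s i))" using a(1)[of "s i"] by linarith
      from close[OF this] show ?case by (simp add: act_add X)
    qed
    then show "dist (T n u) (T n v) \<le> r"
      using dist_act_limit[OF _ uv(4) _ uv(5)] X act_in by blast
  qed
  with that uv(1,2) \<open>u \<noteq> v\<close> show thesis by blast
qed

section \<open>Periodic points\<close>

lemma act_period_mult:
  assumes "x \<in> X" "T k x = x"
  shows "T (j * k) x = x"
proof -
  have nat: "T (int i * k) x = x" for i
    by (induction i) (simp_all add: act_zero assms act_add distrib_right)
  show ?thesis
  proof (cases "j \<ge> 0")
    case True
    then show ?thesis using nat[of "nat j"] by simp
  next
    case False
    then have "T (- (j * k)) x = x" using nat[of "nat (- j)"] by simp
    then show ?thesis using act_inverse(1)[OF assms(1), of "j * k"] by simp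
  qed
qed

lemma periodicI:
  assumes "x \<in> X" "T k x = x" "k \<noteq> 0"
  shows "periodic x"
proof (cases "k > 0")
  case True
  then show ?thesis using assms(2) unfolding periodic_def by blast
next
  case False
  then have "- k > 0" "T (- k) x = x" using act_inverse(2)[OF assms(1), of k] assms(2,3) by simp_all
  then show ?thesis unfolding periodic_def by blast
qed

lemma act_inj_nonperiodic:
  assumes "x \<in> X" "\<not> periodic x" "T m x = T n x"
  shows "m = n"
proof -
  have "T (n - m) x = T (- m) (T n x)"
    using act_add[OF assms(1), of "- m" n] by simp
  also have "\<dots> = x" using act_inverse(2)[OF assms(1), of m] by (simp flip: assms(3))
  finally show ?thesis using periodicI[of x "n - m"] assms by auto
qed

lemma finite_orb_periodic:
  assumes "x \<in> X" "periodic x"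
  shows "finite (orb x)"
proof -
  obtain k where k: "k > 0" "T k x = x" using assms unfolding periodic_def by blast
  have "T n x \<in> (\<lambda>n. T n x) ` {0..<k}" for n
  proof -
    have "T n x = T (n mod k + n div k * k) x" by (simp only: mod_div_mult_eq)
    also have "\<dots> = T (n mod k) (T (n div k * k) x)" by (rule act_add[OF assms(1)])
    also have "\<dots> = T (n mod k) x" by (simp only: act_period_mult[OF assms(1) k(2)])
    finally show ?thesis using k(1) by auto
  qed
  then have "orb x \<subseteq> (\<lambda>n. T n x) ` {0..<k}" unfolding orb_def by blast
  then show ?thesis by (rule finite_subset) simp
qed

lemma periodic_if_finite_orb:
  assumes "x \<in> X" "finite (orb x)"
  shows "periodic x"
proof (rule ccontr)
  assume "\<not> periodic x"
  then have "inj (\<lambda>n. T n x)" using act_inj_nonperiodic[OF assms(1)] by (intro injI)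
  then show False using finite_imageD[of "\<lambda>n. T n x" UNIV] assms(2) infinite_UNIV_int
    unfolding orb_def by simp
qed

lemma orb_eq:
  assumes "x \<in> X" "y \<in> orb x"
  shows "orb y = orb x"
proof -
  obtain k where k: "y = T k x" using assms(2) unfolding orb_def by blast
  have y: "T n y = T (n + k) x" and x: "T n x = T (n - k) y" for n
    using act_add[OF assms(1), of n k] act_add[OF assms(1), of "n - k" k] by (simp_all add: k)
  show ?thesis
  proof
    show "orb y \<subseteq> orb x" unfolding orb_def by (rule image_subsetI) (subst y, rule rangeI)
    show "orb x \<subseteq> orb y" unfolding orb_def by (rule image_subsetI) (subst x, rule rangeI)
  qed
qed

lemma periodic_orb:
  assumes "x \<in> X" "periodic x" "y \<in> orb x"
  shows "periodic y"
proof (rule periodic_if_finite_orb)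
  show "y \<in> X" using orb_subset assms(1,3) by blast
  show "finite (orb y)" using finite_orb_periodic[OF assms(1,2)] orb_eq[OF assms(1,3)] by simp
qed

lemma closed_invariant_periodic_orb:
  assumes "x \<in> X" "periodic x"
  shows "closed_invariant (orb x)"
  unfolding closed_invariant_def
  using finite_imp_closed[OF finite_orb_periodic[OF assms]] orb_subset[OF assms(1)]
    act_in_orb[OF assms(1)] by blast

section \<open>Minimal sets\<close>

text \<open>Zorn's lemma for reverse inclusion; compactness gives a chain a nonempty intersection.\<close>

lemma exists_minimal_subset:
  assumes "closed_invariant S" "S \<noteq> {}"
  obtains M where "minimal M" "M \<subseteq> S"
proof -
  define \<A> where "\<A> = {N. closed_invariant N \<and> N \<noteq> {} \<and> N \<subseteq> S}"
  have "\<exists>M\<in>\<A>. \<forall>N\<in>\<A>. N \<subseteq> M \<longrightarrow> N = M"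
  proof (rule predicate_Zorn[where P = "\<lambda>A B. B \<subseteq> A"])
    show "partial_order_on \<A> (relation_of (\<lambda>A B. B \<subseteq> A) \<A>)"
      by (rule partial_order_on_relation_ofI) auto
    fix \<C> assume C: "\<C> \<in> Chains (relation_of (\<lambda>A B. B \<subseteq> A) \<A>)"
    have sub: "\<C> \<subseteq> \<A>" and tot: "\<And>A B. A \<in> \<C> \<Longrightarrow> B \<in> \<C> \<Longrightarrow> A \<subseteq> B \<or> B \<subseteq> A"
      using C by (auto simp: Chains_def relation_of_def)
    show "\<exists>U\<in>\<A>. \<forall>A\<in>\<C>. U \<subseteq> A"
    proof (cases "\<C> = {}")
      case True
      then show ?thesis using assms unfolding \<A>_def by auto
    next
      case False
      have "\<Inter>\<C> \<noteq> {}"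
      proof -
        have fin: "\<Inter>\<B> \<in> \<C>" if "finite \<B>" "\<B> \<noteq> {}" "\<B> \<subseteq> \<C>" for \<B>
          using that
        proof (induction rule: finite_ne_induct)
          case (insert B \<B>)
          then have "B \<in> \<C>" "\<Inter>\<B> \<in> \<C>" by auto
          from tot[OF this] have "B \<inter> \<Inter>\<B> = B \<or> B \<inter> \<Inter>\<B> = \<Inter>\<B>" by blast
          with \<open>B \<in> \<C>\<close> \<open>\<Inter>\<B> \<in> \<C>\<close> show ?case by auto
        qed simp
        have "S \<inter> \<Inter>\<C> \<noteq> {}"
        proof (rule compact_imp_fip[OF closed_invariant_compact[OF assms(1)]])
          show "closed A" if "A \<in> \<C>" for A
            using that sub unfolding \<A>_def closed_invariant_def by blast
          show "S \<inter> \<Inter>\<B> \<noteq> {}" if "finite \<B>" "\<B> \<subseteq> \<C>" for \<B>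
          proof (cases "\<B> = {}")
            case False
            then have "\<Inter>\<B> \<in> \<A>" using fin that sub by blast
            then show ?thesis unfolding \<A>_def by blast
          qed (use assms in simp)
        qed
        then show ?thesis by blast
      qed
      moreover have "closed_invariant (\<Inter>\<C>)"
        unfolding closed_invariant_def
      proof (intro conjI ballI allI)
        have C: "closed_invariant A" if "A \<in> \<C>" for A using that sub unfolding \<A>_def by blast
        then show "closed (\<Inter>\<C>)" unfolding closed_invariant_def by (intro closed_Inter) blast
        show "\<Inter>\<C> \<subseteq> X" using C False unfolding closed_invariant_def by blast
        show "T n x \<in> \<Inter>\<C>" if "x \<in> \<Inter>\<C>" for x n
          using C that unfolding closed_invariant_def by blast
      qed
      ultimately have "\<Inter>\<C> \<in> \<A>" using sub False unfolding \<A>_def by blast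
      then show ?thesis by blast
    qed
  qed
  then obtain M where M: "M \<in> \<A>" "\<forall>N\<in>\<A>. N \<subseteq> M \<longrightarrow> N = M" by blast
  have "minimal M" using M unfolding minimal_def \<A>_def by auto
  with that M(1) show thesis unfolding \<A>_def by blast
qed

definition omega_limit :: "'a \<Rightarrow> 'a set" where
  "omega_limit x = (\<Inter>N. closure ((\<lambda>n. T n x) ` {N..}))"

lemma closed_invariant_omega_limit:
  assumes "x \<in> X"
  shows "closed_invariant (omega_limit x)"
  unfolding closed_invariant_def
proof (intro conjI ballI allI)
  show "closed (omega_limit x)" unfolding omega_limit_def by auto
  have "closure ((\<lambda>n. T n x) ` {0..}) \<subseteq> X"
    by (rule closure_minimal) (auto simp: closed_space act_in assms)
  then show "omega_limit x \<subseteq> X" unfolding omega_limit_def by auto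
  fix y k assume y: "y \<in> omega_limit x"
  show "T k y \<in> omega_limit x"
    unfolding omega_limit_def
  proof
    fix N
    have "y \<in> closure ((\<lambda>n. T n x) ` {N - k..})" using y unfolding omega_limit_def by blast
    then obtain ys where ys: "\<And>i. ys i \<in> (\<lambda>n. T n x) ` {N - k..}" "ys \<longlonglongrightarrow> y"
      unfolding closure_sequential by blast
    have "ys i \<in> X" for i using ys(1)[of i] act_in[OF assms] by auto
    then have "(\<lambda>i. T k (ys i)) \<longlonglongrightarrow> T k y" using ys(2) by (rule act_tendsto)
    moreover have "T k (ys i) \<in> (\<lambda>n. T n x) ` {N..}" for i
    proof -
      obtain n where "n \<ge> N - k" "ys i = T n x" using ys(1)[of i] by auto
      then have "T k (ys i) = T (k + n) x" "k + n \<in> {N..}" by (simp_all add: act_add assms)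
      then show ?thesis by blast
    qed
    ultimately show "T k y \<in> closure ((\<lambda>n. T n x) ` {N..})"
      unfolding closure_sequential by (intro exI[of _ "\<lambda>i. T k (ys i)"]) simp
  qed
qed

lemma omega_limit_nonempty:
  assumes "x \<in> X"
  shows "omega_limit x \<noteq> {}"
proof -
  have in_X: "T (int i) x \<in> X" for i using assms act_in by blast
  obtain y s where "y \<in> X" and y: "strict_mono (s::nat \<Rightarrow> nat)" "(\<lambda>i. T (int (s i)) x) \<longlonglongrightarrow> y"
    by (rule convergent_subseq[OF compact_space in_X])
  have "y \<in> closure ((\<lambda>n. T n x) ` {N..})" for N
  proof (rule Lim_in_closed_set[OF _ _ _ y(2)])
    have "\<forall>\<^sub>F i in sequentially. N \<le> int (s i)" by (rule strict_mono_int_ge[OF y(1)])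
    then show "\<forall>\<^sub>F i in sequentially. T (int (s i)) x \<in> closure ((\<lambda>n. T n x) ` {N..})"
      by eventually_elim (auto intro!: subsetD[OF closure_subset])
  qed auto
  then show ?thesis unfolding omega_limit_def by blast
qed

lemma periodic_if_mem_finite_minimal:
  assumes "minimal M" "finite M" "x \<in> M"
  shows "x \<in> X" "periodic x"
proof -
  show x: "x \<in> X" using assms unfolding minimal_def closed_invariant_def by auto
  have "orb x \<subseteq> M" using assms unfolding minimal_def closed_invariant_def orb_def by auto
  then show "periodic x" using periodic_if_finite_orb[OF x] finite_subset assms(2) by blast
qed

lemma not_periodic_if_mem_infinite_minimal:
  assumes "minimal M" "infinite M" "x \<in> M"
  shows "x \<in> X" "\<not> periodic x"
proof -
  show x: "x \<in> X" using assms unfolding minimal_def closed_invariant_def by auto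
  have "orb x \<subseteq> M" "orb x \<noteq> {}"
    using assms unfolding minimal_def closed_invariant_def orb_def by auto
  then show "\<not> periodic x"
    using closed_invariant_periodic_orb[OF x] finite_orb_periodic[OF x] assms(1,2)
    unfolding minimal_def by metis
qed

end

section \<open>Separating actions\<close>

locale separating_int_action = compact_int_action +
  fixes \<eta> :: real
  assumes sep_pos: "\<eta> > 0"
    and separating: "x \<in> X \<Longrightarrow> y \<in> X \<Longrightarrow> forever_close \<eta> x y \<Longrightarrow> y \<in> orb x"
begin

text \<open>
  Otherwise the iterates of \<open>x\<close> return uniformly to \<open>x\<close>, and Baire's argument applies to the
  countable orbit: choose nested uniform balls around iterates of \<open>x\<close>, the \<open>i\<close>-th choice avoiding
  the \<open>i\<close>-th point of the orbit. A point common to all of them is within \<open>\<eta>\<close> of \<open>x\<close> forever, so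
  it lies in the orbit by separation, but it has been avoided.
\<close>

lemma nonperiodic_orbit_discrete:
  assumes x: "x \<in> X" "\<not> periodic x"
  obtains c where "c > 0" "\<And>k. k \<noteq> 0 \<Longrightarrow> \<not> forever_close c x (T k x)"
proof (rule ccontr)
  assume "\<not> thesis"
  with that have return: "\<exists>k. k \<noteq> 0 \<and> forever_close c x (T k x)" if "c > 0" for c
    using that by blast
  \<comment> \<open>A pair holds the time of the center and the radius of a ball. Radii are at least halved and centers
     move by at most half the old radius, so that the balls are nested.\<close>
  define good where "good = (\<lambda>i a a'. (0::real) < snd a' \<and> snd a' \<le> snd a / 2 \<and>
      forever_close (snd a / 2) (T (fst a) x) (T (fst a') x) \<and>
      \<not> forever_close (snd a') (T (fst a') x) (T (int_decode i) x))"
  have "\<exists>a. \<forall>i. (0 < snd (a i) \<and> (i = 0 \<longrightarrow> a i = (0, \<eta>))) \<and> good i (a i) (a (Suc i))"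
  proof (rule dependent_nat_choice)
    show "\<exists>a::int \<times> real. 0 < snd a \<and> (0 = (0::nat) \<longrightarrow> a = (0, \<eta>))" using sep_pos by auto
    fix a :: "int \<times> real" and i :: nat
    assume "0 < snd a \<and> (i = 0 \<longrightarrow> a = (0, \<eta>))"
    then have pos: "snd a / 2 > 0" by simp
    define m where "m = int_decode i"
    obtain b where b: "b \<noteq> m" "forever_close (snd a / 2) (T (fst a) x) (T b x)"
    proof (cases "fst a = m")
      case False
      then show ?thesis using that[of "fst a"] pos by (simp add: forever_close_def)
    next
      case True
      obtain k where k: "k \<noteq> 0" "forever_close (snd a / 2) x (T k x)"
        using return[OF pos] by blast
      have "forever_close (snd a / 2) (T (fst a) x) (T (fst a + k) x)"
        using forever_close_act[OF x(1) act_in[OF x(1)] k(2)] by (simp add: act_add x(1))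
      then show ?thesis using that[of "fst a + k"] k(1) True by simp
    qed
    define d where "d = min (snd a / 2) (dist (T b x) (T m x) / 2)"
    have far: "dist (T b x) (T m x) > 0" using act_inj_nonperiodic[OF x] b(1) by auto
    then have "d > 0" "d \<le> snd a / 2" "d < dist (T b x) (T m x)"
      using pos far unfolding d_def by linarith+
    moreover have "dist (T b x) (T m x) \<le> d" if "forever_close d (T b x) (T m x)"
      using that[unfolded forever_close_def, rule_format, of 0] by (simp add: act_zero act_in x(1))
    ultimately have "good i a (b, d)" using b(2) unfolding good_def m_def by fastforce
    with \<open>d > 0\<close> show "\<exists>a'. (0 < snd a' \<and> (Suc i = 0 \<longrightarrow> a' = (0, \<eta>))) \<and> good i a a'"
      by fastforce
  qed
  then obtain a where a: "\<And>i. 0 < snd (a i)" "a 0 = (0, \<eta>)" "\<And>i. good i (a i) (a (Suc i))"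
    by metis
  have nested: "forever_close (snd (a i) - snd (a (i + j))) (T (fst (a i)) x) (T (fst (a (i + j))) x)"
    for i j
  proof (induction j)
    case 0
    show ?case by (simp add: forever_close_def)
  next
    case (Suc j)
    have "forever_close (snd (a (i + j)) / 2) (T (fst (a (i + j))) x) (T (fst (a (i + Suc j))) x)"
      and "snd (a (i + Suc j)) \<le> snd (a (i + j)) / 2"
      using a(3)[of "i + j"] unfolding good_def by auto
    then show ?case using forever_close_trans[OF Suc] forever_close_mono by fastforce
  qed
  have in_X: "T (fst (a i)) x \<in> X" for i using act_in x(1) by blast
  obtain y s where y: "y \<in> X" "strict_mono (s::nat \<Rightarrow> nat)"
      "(\<lambda>i. T (fst (a (s i))) x) \<longlonglongrightarrow> y"
    by (rule convergent_subseq[OF compact_space in_X])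
  \<comment> \<open>The limit of the centers lies in every ball, as the tail of the centers does.\<close>
  have near: "forever_close (snd (a i)) (T (fst (a i)) x) y" for i
    unfolding forever_close_def
  proof
    fix n
    have "\<forall>\<^sub>F j in sequentially. int i \<le> int (s j)" by (rule strict_mono_int_ge[OF y(2)])
    then have "\<forall>\<^sub>F j in sequentially.
        dist (T n (T (fst (a i)) x)) (T n (T (fst (a (s j))) x)) \<le> snd (a i)"
    proof eventually_elim
      case (elim j)
      then have "forever_close (snd (a i) - snd (a (s j))) (T (fst (a i)) x) (T (fst (a (s j))) x)"
        using nested[of i "s j - i"] by simp
      then show ?case
        using a(1)[of "s j"] unfolding forever_close_def by (smt (verit))
    qed
    then show "dist (T n (T (fst (a i)) x)) (T n y) \<le> snd (a i)"
      using dist_act_limit[OF _ tendsto_const _ y(3)] in_X by blast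
  qed
  have "forever_close \<eta> x y" using near[of 0] by (simp add: a(2) act_zero x(1))
  then obtain m where m: "y = T m x"
    using separating[OF x(1) y(1)] unfolding orb_def by blast
  then have "forever_close (snd (a (Suc (int_encode m)))) (T (fst (a (Suc (int_encode m)))) x) (T m x)"
    using near by blast
  then show False using a(3)[of "int_encode m"] unfolding good_def by simp
qed

text \<open>
  For fixed \<open>k\<close> and \<open>c\<close>, the points \<open>z\<close> that stay \<open>c\<close>-close to \<open>T k z\<close> form a closed invariant
  set. By minimality it is empty once it misses a single point, so the constant of one orbit serves
  for the whole minimal set.
\<close>

lemma minimal_orbits_uniformly_discrete:
  assumes M: "minimal M" "infinite M"
  obtains c where "c > 0" "\<And>z k. z \<in> M \<Longrightarrow> k \<noteq> 0 \<Longrightarrow> \<not> forever_close c z (T k z)"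
proof -
  obtain x where x: "x \<in> M" using M unfolding minimal_def by blast
  note xX = not_periodic_if_mem_infinite_minimal[OF M x]
  obtain c where c: "c > 0" "\<And>k. k \<noteq> 0 \<Longrightarrow> \<not> forever_close c x (T k x)"
    using nonperiodic_orbit_discrete[OF xX] by blast
  have inv: "closed M" "M \<subseteq> X" "\<And>z n. z \<in> M \<Longrightarrow> T n z \<in> M"
    using M unfolding minimal_def closed_invariant_def by auto
  have "\<not> forever_close c z (T k z)" if z: "z \<in> M" and k: "k \<noteq> 0" for z k
  proof
    assume zk: "forever_close c z (T k z)"
    define G where "G = {z \<in> M. forever_close c z (T k z)}"
    have "closed_invariant G"
      unfolding closed_invariant_def
    proof (intro conjI ballI allI)
      show "G \<subseteq> X" using inv unfolding G_def by auto
      show "closed G"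
        unfolding closed_sequential_limits
      proof (intro allI impI)
        fix zs w assume zs: "(\<forall>i. zs i \<in> G) \<and> zs \<longlonglongrightarrow> w"
        then have inX: "zs i \<in> X" and M': "zs i \<in> M" for i using inv unfolding G_def by auto
        then have "w \<in> M" using zs closed_sequentially inv(1) by blast
        moreover have "forever_close c w (T k w)"
          unfolding forever_close_def
        proof
          fix n
          have "\<forall>\<^sub>F i in sequentially. dist (T n (zs i)) (T n (T k (zs i))) \<le> c"
            using zs unfolding G_def forever_close_def by auto
          then show "dist (T n w) (T n (T k w)) \<le> c"
            using zs by (intro dist_act_limit[OF inX _ act_in[OF inX] act_tendsto[OF inX]]) auto
        qed
        ultimately show "w \<in> G" unfolding G_def by blast
      qed
      fix w n assume w: "w \<in> G"
      then have wX: "w \<in> X" using \<open>G \<subseteq> X\<close> by blast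
      have "forever_close c (T n w) (T n (T k w))"
        using forever_close_act[OF wX act_in[OF wX]] w unfolding G_def by blast
      then show "T n w \<in> G"
        using w inv(3) unfolding G_def by (simp add: wX add.commute flip: act_add)
    qed
    moreover have "z \<in> G" "G \<subseteq> M" using z zk unfolding G_def by auto
    ultimately have "G = M" using M(1) unfolding minimal_def by blast
    then show False using x c(2)[OF k] unfolding G_def by blast
  qed
  with that c(1) show thesis by blast
qed

text \<open>
  On \<open>M\<close> the action is expansive with some constant \<open>e\<close>. Without asymptotic pairs, points that are
  \<open>e\<close>-close in the future coincide; by compactness, closeness at the times \<open>1, \<dots>, N\<close> already forces
  closeness at time \<open>0\<close>, and inductively at all earlier times. Two sufficiently close points of one
  forward orbit are then \<open>e\<close>-close in the whole past. A limit point of their common past stays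
  \<open>e\<close>-close forever to a proper iterate of itself, against the uniform discreteness of orbits.
\<close>

lemma infinite_minimal_asymptotic:
  assumes M: "minimal M" "infinite M"
  shows "\<exists>x\<in>M. \<exists>y\<in>M. x \<noteq> y \<and> asymptotic x y"
proof (rule ccontr)
  assume "\<not> ?thesis"
  then have no_asym: "z = w" if "z \<in> M" "w \<in> M" "asymptotic z w" for z w using that by blast
  have inv: "closed_invariant M" "M \<subseteq> X" "\<And>z n. z \<in> M \<Longrightarrow> T n z \<in> M"
    using M unfolding minimal_def closed_invariant_def by auto
  have compM: "compact M" using inv(1) closed_invariant_compact by blast
  obtain c where c: "c > 0" "\<And>z k. z \<in> M \<Longrightarrow> k \<noteq> 0 \<Longrightarrow> \<not> forever_close c z (T k z)"
    using minimal_orbits_uniformly_discrete[OF M] by blast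
  define e where "e = min c \<eta>"
  have e: "e > 0" "e \<le> c" "e \<le> \<eta>" using c sep_pos unfolding e_def by auto
  have expansive: "z = w" if zw: "z \<in> M" "w \<in> M" "forever_close e z w" for z w
  proof -
    have "w \<in> orb z" using zw inv(2) e(3) separating forever_close_mono by blast
    then obtain k where k: "w = T k z" unfolding orb_def by blast
    then have "k = 0" using c(2)[of z k] zw forever_close_mono[OF _ e(2)] by blast
    then show ?thesis using k act_zero inv(2) zw(1) by auto
  qed
  have pos_expansive: "z = w"
    if zw: "z \<in> M" "w \<in> M" "\<And>n. 0 \<le> n \<Longrightarrow> dist (T n z) (T n w) \<le> e" for z w
    using asymptotic_or_forever_close_pair[OF inv(1) zw(1) inv(1) zw(2) zw(3)] expansive no_asym zw
    by metis
  have "\<exists>N::nat. \<forall>z\<in>M. \<forall>w\<in>M. (\<forall>n\<in>{1..int N}. dist (T n z) (T n w) \<le> e) \<longrightarrow> dist z w \<le> e"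
  proof (rule ccontr)
    assume "\<not> ?thesis"
    then obtain z w where zw: "\<And>N. z N \<in> M" "\<And>N. w N \<in> M"
      "\<And>N n. n \<in> {1..int N} \<Longrightarrow> dist (T n (z N)) (T n (w N)) \<le> e"
      "\<And>N. \<not> dist (z N) (w N) \<le> e" by metis
    obtain u v s where uv: "u \<in> M" "v \<in> M" "strict_mono (s::nat \<Rightarrow> nat)"
      "(\<lambda>i. z (s i)) \<longlonglongrightarrow> u" "(\<lambda>i. w (s i)) \<longlonglongrightarrow> v"
      by (rule convergent_pair_subseq[OF compM compM zw(1,2)])
    have "e \<le> dist u v"
      by (rule tendsto_lowerbound[OF tendsto_dist[OF uv(4,5)]]) (use zw(4) in \<open>auto simp: not_le less_imp_le\<close>)
    \<comment> \<open>The limit pair is close only at times from 1 on, so positive expansivity is applied one step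
       later.\<close>
    have "dist (T n (T 1 u)) (T n (T 1 v)) \<le> e" if "0 \<le> n" for n
    proof -
      have "\<forall>\<^sub>F i in sequentially. n + 1 \<le> int (s i)" by (rule strict_mono_int_ge[OF uv(3)])
      then have "\<forall>\<^sub>F i in sequentially. dist (T (n + 1) (z (s i))) (T (n + 1) (w (s i))) \<le> e"
        by eventually_elim (use that zw(3) in auto)
      then have "dist (T (n + 1) u) (T (n + 1) v) \<le> e"
        using dist_act_limit[OF subsetD[OF inv(2) zw(1)] uv(4) subsetD[OF inv(2) zw(2)] uv(5)] by blast
      then show ?thesis by (simp only: act_add[OF subsetD[OF inv(2)]] uv(1,2))
    qed
    then have "T 1 u = T 1 v" using pos_expansive inv(3) uv(1,2) by blast
    then have "u = v" using act_inj inv(2) uv by blast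
    then show False using \<open>e \<le> dist u v\<close> e by simp
  qed
  then obtain N :: nat where N: "\<And>z w. z \<in> M \<Longrightarrow> w \<in> M \<Longrightarrow>
      (\<forall>n\<in>{1..int N}. dist (T n z) (T n w) \<le> e) \<Longrightarrow> dist z w \<le> e" by blast
  obtain x where x: "x \<in> M" using M unfolding minimal_def by blast
  have xs: "T (int i) x \<in> M" for i using x inv(3) by blast
  obtain l s where "l \<in> M" and l: "strict_mono (s::nat \<Rightarrow> nat)" "(\<lambda>i. T (int (s i)) x) \<longlonglongrightarrow> l"
    by (rule convergent_subseq[OF compM xs])
  \<comment> \<open>Consecutive terms of a convergent subsequence of the forward orbit are close at the times
     \<open>1, \<dots>, N\<close>.\<close>
  have "\<forall>\<^sub>F i in sequentially. \<forall>n\<in>{1..int N}.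
      dist (T n (T (int (s i)) x)) (T n (T (int (s (Suc i))) x)) < e"
  proof (rule eventually_ball_finite)
    show "\<forall>n\<in>{1..int N}. \<forall>\<^sub>F i in sequentially.
      dist (T n (T (int (s i)) x)) (T n (T (int (s (Suc i))) x)) < e"
    proof
      fix n
      have lim: "(\<lambda>i. T n (T (int (s i)) x)) \<longlonglongrightarrow> T n l"
        using act_tendsto[OF subsetD[OF inv(2) xs] l(2)] .
      have "(\<lambda>i. dist (T n (T (int (s i)) x)) (T n (T (int (s (Suc i))) x))) \<longlonglongrightarrow> 0"
        using tendsto_dist[OF lim LIMSEQ_Suc[OF lim]] by simp
      then show "\<forall>\<^sub>F i in sequentially.
          dist (T n (T (int (s i)) x)) (T n (T (int (s (Suc i))) x)) < e"
        using order_tendstoD(2) e(1) by blast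
    qed
  qed simp
  then obtain i where i: "\<And>n. n \<in> {1..int N} \<Longrightarrow>
      dist (T n (T (int (s i)) x)) (T n (T (int (s (Suc i))) x)) < e"
    unfolding eventually_sequentially by blast
  define z where "z = T (int (s i)) x"
  define k where "k = int (s (Suc i)) - int (s i)"
  have k: "k \<noteq> 0" using l(1) unfolding k_def strict_mono_def by (metis lessI less_irrefl of_nat_eq_iff right_minus_eq)
  have zM: "z \<in> M" and zX: "z \<in> X" using xs inv(2) unfolding z_def by auto
  have kz: "T k z = T (int (s (Suc i))) x"
    unfolding z_def k_def using x inv(2) by (auto simp flip: act_add)
  have backward: "\<forall>n\<in>{1 - int m..int N}. dist (T n z) (T n (T k z)) \<le> e" for m
  proof (induction m)
    case 0
    then show ?case using i unfolding kz by (auto simp: z_def less_imp_le)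
  next
    case (Suc m)
    have "dist (T (- int m) z) (T (- int m) (T k z)) \<le> e"
    proof (rule N)
      show "\<forall>n\<in>{1..int N}. dist (T n (T (- int m) z)) (T n (T (- int m) (T k z))) \<le> e"
      proof
        fix n assume "n \<in> {1..int N}"
        then have "n + - int m \<in> {1 - int m..int N}" by auto
        with Suc have "dist (T (n + - int m) z) (T (n + - int m) (T k z)) \<le> e" by blast
        then show "dist (T n (T (- int m) z)) (T n (T (- int m) (T k z))) \<le> e"
          by (simp only: act_add[OF zX] act_add[OF act_in[OF zX]])
      qed
    qed (use zM inv(3) in auto)
    moreover have "n = - int m \<or> n \<in> {1 - int m..int N}" if "n \<in> {1 - int (Suc m)..int N}" for n
      using that by auto
    ultimately show ?case using Suc by blast
  qed
  have zs: "T (- int j) z \<in> M" for j using zM inv(3) by blast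
  obtain u t where u: "u \<in> M" "strict_mono (t::nat \<Rightarrow> nat)" "(\<lambda>j. T (- int (t j)) z) \<longlonglongrightarrow> u"
    by (rule convergent_subseq[OF compM zs])
  have lim: "(\<lambda>j. T k (T (- int (t j)) z)) \<longlonglongrightarrow> T k u"
    using act_tendsto[OF subsetD[OF inv(2) zs] u(3)] .
  have "forever_close e u (T k u)"
    unfolding forever_close_def
  proof
    fix n
    have "\<forall>\<^sub>F j in sequentially. n \<le> int (t j)" by (rule strict_mono_int_ge[OF u(2)])
    then have "\<forall>\<^sub>F j in sequentially.
        dist (T n (T (- int (t j)) z)) (T n (T k (T (- int (t j)) z))) \<le> e"
    proof eventually_elim
      case (elim j)
      have "n - int (t j) \<in> {1 - int (nat (1 - n + int (t j)))..int N}" using elim by auto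
      then have "dist (T (n - int (t j)) z) (T (n - int (t j)) (T k z)) \<le> e" using backward by blast
      moreover have "T (n - int (t j)) (T k z) = T n (T k (T (- int (t j)) z))"
        using zX act_in by (simp add: algebra_simps flip: act_add)
      moreover have "T (n - int (t j)) z = T n (T (- int (t j)) z)"
        using zX by (simp flip: act_add)
      ultimately show ?case by simp
    qed
    then show "dist (T n u) (T n (T k u)) \<le> e"
      using dist_act_limit[OF subsetD[OF inv(2) zs] u(3) subsetD[OF inv(2) inv(3)[OF zs]] lim] by blast
  qed
  then show False using c(2)[OF u(1) k] forever_close_mono[OF _ e(2)] by blast
qed

text \<open>
  By separation a point that stays close to a periodic orbit with a fixed phase lies on it, and below
  the minimal distance in the finite orbit the phase is determined.
\<close>

lemma periodic_isolation_radius: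
  assumes "p \<in> X" "periodic p"
  obtains r where "0 < r"
    "\<And>q y. q \<in> orb p \<Longrightarrow> y \<in> X \<Longrightarrow> forever_close r q y \<Longrightarrow> y = q"
proof -
  have fin: "finite (orb p)" using finite_orb_periodic assms by blast
  obtain d where d: "d > 0" "\<And>u v. u \<in> orb p \<Longrightarrow> v \<in> orb p \<Longrightarrow> u \<noteq> v \<Longrightarrow> d \<le> dist u v"
  proof -
    define D where "D = insert 1 ((\<lambda>(u, v). dist u v) ` {(u, v) \<in> orb p \<times> orb p. u \<noteq> v})"
    have "finite {(u, v) \<in> orb p \<times> orb p. u \<noteq> v}"
      by (rule finite_subset[of _ "orb p \<times> orb p"]) (use fin in auto)
    then have D: "finite D" unfolding D_def by blast
    have "Min D > 0" using D by (subst Min_gr_iff) (auto simp: D_def)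
    moreover have "Min D \<le> dist u v" if "u \<in> orb p" "v \<in> orb p" "u \<noteq> v" for u v
      using that by (intro Min_le[OF D]) (force simp: D_def)
    ultimately show thesis using that by blast
  qed
  define r where "r = min (d / 2) \<eta>"
  have r: "0 < r" "r < d" "r \<le> \<eta>" using d(1) sep_pos unfolding r_def by auto
  have "y = q" if q: "q \<in> orb p" and y: "y \<in> X" "forever_close r q y" for q y
  proof -
    have qX: "q \<in> X" using q orb_subset assms by blast
    have "y \<in> orb q" using separating[OF qX y(1)] y(2) r(3) forever_close_mono by blast
    then have "y \<in> orb p" using orb_eq[OF assms(1) q] by simp
    moreover have "dist q y \<le> r"
      using y(2)[unfolded forever_close_def, rule_format, of 0] by (simp add: act_zero qX y(1))
    ultimately show ?thesis using d(2)[OF q, of y] r(2) by fastforce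
  qed
  with that r show thesis by blast
qed

text \<open>
  Going back from \<open>xs i\<close>, let \<open>a i\<close> be the first number of steps after which the distance to the
  orbit of \<open>p\<close>, at the matching phase, exceeds \<open>r\<close>. Since \<open>xs\<close> tends to \<open>p\<close>, the
  numbers \<open>a i\<close> tend to infinity. A limit of the points at time \<open>- a i\<close> thus has distance at least
  \<open>r\<close> from a phase \<open>p'\<close> of the orbit, while at every later time their distance is at most \<open>r\<close>. As
  \<open>r\<close> isolates the periodic orbit, the two points are asymptotic.
\<close>

lemma asymptotic_at_entrance:
  assumes p: "p \<in> X" "periodic p"
    and r: "0 < r" "\<And>q y. q \<in> orb p \<Longrightarrow> y \<in> X \<Longrightarrow> forever_close r q y \<Longrightarrow> y = q"
    and xs: "\<And>i. xs i \<in> X" "xs \<longlonglongrightarrow> p"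
    and escape: "\<And>i. \<exists>n\<ge>0. dist (T (- n) (xs i)) (T (- n) p) > r"
  shows "\<exists>x\<in>X. \<exists>y\<in>X. x \<noteq> y \<and> asymptotic x y"
proof -
  have "\<exists>a. \<forall>i. dist (T (- int (a i)) (xs i)) (T (- int (a i)) p) > r
     \<and> (\<forall>b<a i. dist (T (- int b) (xs i)) (T (- int b) p) \<le> r)"
  proof (rule choice, rule allI)
    fix i
    have "\<exists>b. dist (T (- int b) (xs i)) (T (- int b) p) > r"
      using escape[of i] by (metis nat_0_le)
    from exists_least_iff[THEN iffD1, OF this]
    show "\<exists>a. dist (T (- int a) (xs i)) (T (- int a) p) > r
     \<and> (\<forall>b<a. dist (T (- int b) (xs i)) (T (- int b) p) \<le> r)" by (auto simp: not_less)
  qed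
  then obtain a where a: "\<And>i. dist (T (- int (a i)) (xs i)) (T (- int (a i)) p) > r"
    "\<And>i b. b < a i \<Longrightarrow> dist (T (- int b) (xs i)) (T (- int b) p) \<le> r" by blast
  have a_large: "\<forall>\<^sub>F i in sequentially. b < a i" for b
  proof -
    have "\<forall>\<^sub>F i in sequentially. \<forall>n\<in>{..b}. dist (T (- int n) (xs i)) (T (- int n) p) < r"
    proof (rule eventually_ball_finite)
      have "\<forall>\<^sub>F i in sequentially. dist (T (- int n) (xs i)) (T (- int n) p) < r" for n
        using tendstoD[OF act_tendsto[OF xs] r(1)] .
      then show "\<forall>n\<in>{..b}. \<forall>\<^sub>F i in sequentially. dist (T (- int n) (xs i)) (T (- int n) p) < r"
        by blast
    qed simp
    then show ?thesis
      by eventually_elim (metis a(1) atMost_iff linorder_not_less order_less_asym)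
  qed
  have orbc: "closed_invariant (orb p)" using closed_invariant_periodic_orb[OF p] .
  have in_X: "T (- int (a i)) (xs i) \<in> X" and in_P: "T (- int (a i)) p \<in> orb p" for i
    using act_in xs(1) unfolding orb_def by auto
  obtain q p' s where q: "q \<in> X" "p' \<in> orb p" "strict_mono (s::nat \<Rightarrow> nat)"
    "(\<lambda>i. T (- int (a (s i))) (xs (s i))) \<longlonglongrightarrow> q" "(\<lambda>i. T (- int (a (s i))) p) \<longlonglongrightarrow> p'"
    by (rule convergent_pair_subseq[OF compact_space closed_invariant_compact[OF orbc] in_X in_P])
  have p'X: "p' \<in> X" using q(2) orb_subset p by blast
  have "r \<le> dist q p'"
    by (rule tendsto_lowerbound[OF tendsto_dist[OF q(4,5)]]) (simp_all add: less_imp_le a(1))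
  then have "q \<noteq> p'" using r(1) by auto
  then have ne: "T 1 q \<noteq> T 1 p'" using act_inj[OF q(1) p'X] by blast
  have near: "dist (T n (T 1 q)) (T n (T 1 p')) \<le> r" if n: "0 \<le> n" for n
  proof -
    have "\<forall>\<^sub>F i in sequentially. nat n < a (s i)"
      using a_large[of "nat n"] q(3) eventually_subseq by blast
    then have "\<forall>\<^sub>F i in sequentially. dist (T (n + 1) (T (- int (a (s i))) (xs (s i))))
       (T (n + 1) (T (- int (a (s i))) p)) \<le> r"
    proof eventually_elim
      case (elim i)
      define b where "b = a (s i) - nat (n + 1)"
      have b: "b < a (s i)" "n + 1 + - int (a (s i)) = - int b" using elim n unfolding b_def by auto
      have "T (n + 1) (T (- int (a (s i))) y) = T (- int b) y" if "y \<in> X" for y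
        using act_add[OF that, of "n + 1" "- int (a (s i))"] b(2) by simp
      then show ?case using a(2)[OF b(1)] xs(1) p(1) by simp
    qed
    then have "dist (T (n + 1) q) (T (n + 1) p') \<le> r"
      using dist_act_limit[OF in_X q(4) act_in[OF p(1)] q(5)] by blast
    then show ?thesis by (simp only: act_add q(1) p'X)
  qed
  have "asymptotic (T 1 q) (T 1 p')"
  proof (rule ccontr)
    assume "\<not> ?thesis"
    from asymptotic_or_forever_close_pair[OF closed_invariant_space act_in[OF q(1)] orbc
        act_in_orb[OF p(1) q(2)] near this]
    obtain u v where "u \<in> X" "v \<in> orb p" "u \<noteq> v" "forever_close r u v" by blast
    then show False using r(2) forever_close_sym by blast
  qed
  then show ?thesis using ne act_in q(1) p'X by blast
qed

text \<open>
  The visits of \<open>x\<close> to ever smaller neighbourhoods of \<open>p\<close> are entrances, up to finitely many: if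
  infinitely many of them had their whole past \<open>r\<close>-close to the past of \<open>p\<close>, infinitely many of
  these would agree in the phase, and \<open>x\<close> would follow the periodic orbit forever, hence lie on it.
\<close>

lemma nonperiodic_omega_periodic_asymptotic:
  assumes x: "x \<in> X" "\<not> periodic x" and p: "p \<in> omega_limit x" "periodic p"
  shows "\<exists>x\<in>X. \<exists>y\<in>X. x \<noteq> y \<and> asymptotic x y"
proof -
  have pX: "p \<in> X" using closed_invariant_omega_limit[OF x(1)] p(1)
    unfolding closed_invariant_def by blast
  obtain r where r: "0 < r"
      "\<And>q y. q \<in> orb p \<Longrightarrow> y \<in> X \<Longrightarrow> forever_close r q y \<Longrightarrow> y = q"
    using periodic_isolation_radius[OF pX p(2)] by blast
  have "\<exists>a. a \<ge> int i \<and> dist (T a x) p < inverse (real (Suc i))" for i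
  proof -
    have "p \<in> closure ((\<lambda>n. T n x) ` {int i..})" using p(1) unfolding omega_limit_def by blast
    then show ?thesis
      unfolding closure_approachable by (metis (no_types, lifting) atLeast_iff imageE inverse_positive_iff_positive of_nat_0_less_iff zero_less_Suc)
  qed
  then obtain a where a: "\<And>i. a i \<ge> int i" "\<And>i. dist (T (a i) x) p < inverse (real (Suc i))"
    by metis
  have lim: "(\<lambda>i. T (a i) x) \<longlonglongrightarrow> p"
  proof (rule metric_tendsto_imp_tendsto[OF LIMSEQ_inverse_real_of_nat])
    have "dist (T (a i) x) p \<le> dist (inverse (real (Suc i))) 0" for i
      using a(2)[of i] by (simp add: dist_real_def)
    then show "\<forall>\<^sub>F i in sequentially. dist (T (a i) x) p \<le> dist (inverse (real (Suc i))) 0"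
      by (rule always_eventually[OF allI])
  qed
  define I where "I = {i. \<forall>n\<ge>0. dist (T (- n) (T (a i) x)) (T (- n) p) \<le> r}"
  have "finite I"
  proof (rule ccontr)
    assume inf: "infinite I"
    have "finite ((\<lambda>i. T (- a i) p) ` I)"
      by (rule finite_subset[OF _ finite_orb_periodic[OF pX p(2)]]) (auto simp: orb_def)
    then obtain i0 where i0: "infinite {i \<in> I. T (- a i) p = T (- a i0) p}"
      using pigeonhole_infinite[OF inf] by blast
    define q where "q = T (- a i0) p"
    have q: "q \<in> orb p" unfolding q_def orb_def by blast
    have "forever_close r q x"
      unfolding forever_close_def
    proof
      fix n
      obtain i where i: "i \<ge> nat n" "i \<in> I" "T (- a i) p = q"
        using i0 unfolding q_def infinite_nat_iff_unbounded_le by blast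
      then have "a i - n \<ge> 0" using a(1)[of i] by linarith
      then have "dist (T (- (a i - n)) (T (a i) x)) (T (- (a i - n)) p) \<le> r"
        using i(2) unfolding I_def by blast
      moreover have "T (- (a i - n)) (T (a i) x) = T n x"
        using x(1) by (simp flip: act_add)
      moreover have "T (- (a i - n)) p = T n q"
        using pX by (simp flip: act_add i(3))
      ultimately show "dist (T n q) (T n x) \<le> r" by (simp add: dist_commute)
    qed
    then have "x = q" using r(2) q x(1) by blast
    then show False using periodic_orb[OF pX p(2) q] x(2) by blast
  qed
  then obtain N where N: "\<And>i. i \<ge> N \<Longrightarrow> i \<notin> I"
    by (meson finite_nat_set_iff_bounded_le not_less_eq_eq)
  show ?thesis
  proof (rule asymptotic_at_entrance[OF pX p(2) r, where xs = "\<lambda>i. T (a (i + N)) x"])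
    show "(\<lambda>i. T (a (i + N)) x) \<longlonglongrightarrow> p" using LIMSEQ_ignore_initial_segment[OF lim] .
    show "\<exists>n\<ge>0. r < dist (T (- n) (T (a (i + N)) x)) (T (- n) p)" for i
      using N[of "i + N"] unfolding I_def by (auto simp: not_le)
  qed (use act_in x in auto)
qed

text \<open>
  A periodic point that is close to \<open>p\<close> in the whole past is close to \<open>p\<close> at all times, as
  multiples of both periods carry every time into the past. So the points off the orbit of \<open>p\<close> that
  accumulate at \<open>p\<close> have all been far from it at some past time.
\<close>

lemma all_periodic_asymptotic:
  assumes "infinite X" and per: "\<And>x. x \<in> X \<Longrightarrow> periodic x"
  shows "\<exists>x\<in>X. \<exists>y\<in>X. x \<noteq> y \<and> asymptotic x y"
proof -
  obtain p where p: "p \<in> X" "p islimpt X"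
    using compact_space assms(1) compact_eq_Bolzano_Weierstrass by (metis order_refl)
  obtain r where r: "0 < r"
      "\<And>q y. q \<in> orb p \<Longrightarrow> y \<in> X \<Longrightarrow> forever_close r q y \<Longrightarrow> y = q"
    using periodic_isolation_radius[OF p(1) per[OF p(1)]] by blast
  have "orb p \<union> (X - orb p) = X" using orb_subset p(1) by blast
  then have "p islimpt (X - orb p)"
    using p(2) islimpt_Un[of p "orb p" "X - orb p"] islimpt_finite finite_orb_periodic[OF p(1) per[OF p(1)]]
    by auto
  then obtain xs where xs: "\<And>i. xs i \<in> X - orb p" "xs \<longlonglongrightarrow> p"
    unfolding islimpt_sequential by blast
  have escape: "\<exists>n\<ge>0. r < dist (T (- n) y) (T (- n) p)" if y: "y \<in> X - orb p" for y
  proof (rule ccontr)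
    assume "\<not> ?thesis"
    then have near: "\<And>n. n \<ge> 0 \<Longrightarrow> dist (T (- n) y) (T (- n) p) \<le> r" by (auto simp: not_less)
    obtain k m where k: "k > 0" "T k y = y" and m: "m > 0" "T m p = p"
      using per[of y] per[OF p(1)] y unfolding periodic_def by blast
    have "forever_close r p y"
      unfolding forever_close_def
    proof
      fix n
      \<comment> \<open>A common multiple of both periods that moves the time \<open>n\<close> into the past.\<close>
      define j where "j = - \<bar>n\<bar> * (k * m)"
      have "\<bar>n\<bar> * 1 \<le> \<bar>n\<bar> * (k * m)"
        using k(1) m(1) by (intro mult_left_mono) (smt (verit) mult_pos_pos, simp)
      then have "- (n + j) \<ge> 0" unfolding j_def by linarith
      from near[OF this] have "dist (T (n + j) y) (T (n + j) p) \<le> r" by (simp only: minus_minus)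
      moreover have "T j y = y" "T j p = p"
        using act_period_mult[OF _ k(2), of "- \<bar>n\<bar> * m"] act_period_mult[OF p(1) m(2), of "- \<bar>n\<bar> * k"] y
        unfolding j_def by (simp_all add: ac_simps)
      ultimately show "dist (T n p) (T n y) \<le> r"
        using act_add y p(1) by (simp add: dist_commute)
    qed
    moreover have "p \<in> orb p" using act_zero[OF p(1)] rangeI[of "\<lambda>n. T n p" 0] unfolding orb_def by simp
    ultimately show False using r(2)[of p y] y by blast
  qed
  show ?thesis
  proof (rule asymptotic_at_entrance[OF p(1) per[OF p(1)] r, where xs = xs])
    show "xs i \<in> X" for i using xs(1)[of i] by blast
    show "xs \<longlonglongrightarrow> p" by (rule xs(2))
    show "\<exists>n\<ge>0. r < dist (T (- n) (xs i)) (T (- n) p)" for i by (rule escape[OF xs(1)])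
  qed
qed

theorem exists_asymptotic_pair:
  assumes "infinite X"
  shows "\<exists>x\<in>X. \<exists>y\<in>X. x \<noteq> y \<and> asymptotic x y"
proof (cases "\<forall>x\<in>X. periodic x")
  case True
  then show ?thesis by (intro all_periodic_asymptotic[OF assms]) blast
next
  case False
  then obtain x where x: "x \<in> X" "\<not> periodic x" by blast
  obtain M where M: "minimal M" "M \<subseteq> omega_limit x"
    by (rule exists_minimal_subset[OF closed_invariant_omega_limit omega_limit_nonempty, OF x(1) x(1)])
  show ?thesis
  proof (cases "finite M")
    case True
    obtain p where p: "p \<in> M" using M unfolding minimal_def by blast
    then have "p \<in> omega_limit x" using M(2) by blast
    then show ?thesis
      by (rule nonperiodic_omega_periodic_asymptotic[OF x])
         (rule periodic_if_mem_finite_minimal(2)[OF M(1) True p])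
  next
    case False
    have "M \<subseteq> X" using M(1) unfolding minimal_def closed_invariant_def by blast
    then show ?thesis using infinite_minimal_asymptotic[OF M(1) False] by blast
  qed
qed

end

section \<open>Iterates of a homeomorphism\<close>

lemma int_iterate_action:
  assumes "compact X" "self_homeomorphism X f"
  shows "compact_int_action X (int_iterate X f)"
proof -
  obtain g where hom: "homeomorphism X X f g" using assms(2) unfolding self_homeomorphism_def by blast
  define h where "h = inv_into X f"
  have inj: "inj_on f X" using hom by (metis homeomorphism_def inj_on_inverseI)
  have fX: "f ` X = X" using hom by (simp add: homeomorphism_def)
  have hX: "h x \<in> X" and fh: "f (h x) = x" if "x \<in> X" for x
    using that fX inv_into_into[of x f X] f_inv_into_f[of x f X] unfolding h_def by auto
  have hf: "h (f x) = x" if "x \<in> X" for x using that inj unfolding h_def by simp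
  have hg: "h x = g x" if "x \<in> X" for x
    using that hom hf hX fh by (metis homeomorphism_def)
  have contf: "continuous_on X f" and conth: "continuous_on X h"
    using hom continuous_on_cong[of X X h g] hg by (auto simp: homeomorphism_def)
  have f_in: "f x \<in> X" if "x \<in> X" for x using that fX by blast
  have pow_in: "(f ^^ n) x \<in> X" "(h ^^ n) x \<in> X" if "x \<in> X" for n x
    using that by (induction n) (auto intro: f_in hX)
  have pow_cont: "continuous_on X (k ^^ n)"
    if "continuous_on X k" "\<And>x. x \<in> X \<Longrightarrow> k x \<in> X" for k :: "'a \<Rightarrow> 'a" and n
  proof (induction n)
    case 0
    show ?case by (simp add: id_def)
  next
    case (Suc n)
    have "(k ^^ n) x \<in> X" if "x \<in> X" for x
      using that \<open>\<And>x. x \<in> X \<Longrightarrow> k x \<in> X\<close> by (induction n) auto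
    then have "continuous_on ((k ^^ n) ` X) k"
      using continuous_on_subset[OF \<open>continuous_on X k\<close>] by blast
    then show ?case using continuous_on_compose[OF Suc] by simp
  qed
  have in_X: "int_iterate X f n x \<in> X" if "x \<in> X" for n x
    using pow_in that unfolding int_iterate_def h_def by simp
  have step: "int_iterate X f (n + 1) x = f (int_iterate X f n x)" if x: "x \<in> X" for n x
  proof (cases "n \<ge> 0")
    case True
    then have "nat (n + 1) = Suc (nat n)" by simp
    then show ?thesis using True unfolding int_iterate_def by simp
  next
    case False
    then have "nat (- n) = Suc (nat (- (n + 1)))" by simp
    moreover have "n + 1 = 0" if "0 \<le> n + 1" using that False by simp
    ultimately show ?thesis
      using False fh pow_in(2)[OF x] unfolding int_iterate_def h_def[symmetric] by auto
  qed
  have step': "int_iterate X f (n - 1) x = h (int_iterate X f n x)" if "x \<in> X" for n x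
    using step[OF that, of "n - 1"] hf in_X[OF that] by simp
  show ?thesis
  proof
    show "int_iterate X f (m + n) x = int_iterate X f m (int_iterate X f n x)" if x: "x \<in> X" for m n x
    proof (induction m rule: int_induct[where k = 0])
      case base
      show ?case by (simp add: int_iterate_def)
    next
      case (step1 i)
      have "i + 1 + n = i + n + 1" by simp
      then show ?case using step1 by (simp only: step[OF x] step[OF in_X[OF x]])
    next
      case (step2 i)
      have "i - 1 + n = i + n - 1" by simp
      then show ?case using step2 by (simp only: step'[OF x] step'[OF in_X[OF x]])
    qed
    show "continuous_on X (int_iterate X f n)" for n
      using pow_cont[OF contf f_in] pow_cont[OF conth hX] unfolding int_iterate_def h_def by simp
    show "int_iterate X f 0 x = x" for x by (simp add: int_iterate_def)
  qed (simp_all add: assms(1) in_X)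
qed

theorem corollary2p9:
  fixes X :: "'a::metric_space set" and f :: "'a \<Rightarrow> 'a"
  assumes "compact X"
    and "infinite X"
    and "separating_homeomorphism X f"
  shows "\<exists>x\<in>X. \<exists>y\<in>X. x \<noteq> y \<and> (\<lambda>n::nat. dist ((f ^^ n) x) ((f ^^ n) y)) \<longlonglongrightarrow> 0"
proof -
  have "self_homeomorphism X f" using assms(3) by (simp add: separating_homeomorphism_def)
  then interpret compact_int_action X "int_iterate X f"
    using int_iterate_action assms(1) by blast
  obtain \<eta> where \<eta>: "\<eta> > 0" "\<forall>x\<in>X. \<forall>y\<in>X. y \<notin> orbit_on X f x \<longrightarrow>
        (\<exists>n::int. dist (int_iterate X f n x) (int_iterate X f n y) > \<eta>)"
    using assms(3) by (auto simp: separating_homeomorphism_def)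
  interpret separating_int_action X "int_iterate X f" \<eta>
  proof
    show "y \<in> orb x" if "x \<in> X" "y \<in> X" "forever_close \<eta> x y" for x y
      using \<eta>(2) that unfolding orb_def forever_close_def orbit_on_def by (meson linorder_not_le)
  qed (fact \<eta>(1))
  show ?thesis
    using exists_asymptotic_pair[OF assms(2)] unfolding asymptotic_def by (simp add: int_iterate_def)
qed

end
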